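(* Let $R$ be an integral domain of characteristic $0$, let $S\subset\mathbb{N}$ be a $\Leftrightarrow_R$-connected subset, and let $n\in S$. Assume that $R$ is $p$-adically separated for each odd prime factor $p$ of $n$, and also that if $4\mid n$ then $R$ is $2$-adically separated. Let $\zeta$ be a primitive $n$th root of unity (in an algebraic closure of the fraction field of $R$; it may or may not lie in $R$). Then the homomorphism $\sigma^R_{S,\zeta}\colon R[q]^S\to R[\zeta][[q-\zeta]]$ induced by the inclusion $R[q]\subset R[\zeta][q]$ is injective. In particular, for any root of unity $\zeta$ the homomorphism $\sigma^{\mathbb{Z}}_{\mathbb{N},\zeta}\colon\mathbb{Z}[q]^{\mathbb{N}}\to\mathbb{Z}[\zeta][[q-\zeta]]$ is injective.
   Context: All rings are commutative with unit; $q$ is an indeterminate. For $n\in\mathbb{N}$, $\Phi_n(q)$ is the $n$th cyclotomic polynomial. For $S\subset\mathbb{N}$, $\Phi_S^*$ is the multiplicative subset of $\mathbb{Z}[q]$ generated by $\{\Phi_m(q):m\in S\}$, directed by divisibility, and $R[q]^S=\varprojlim_{f\in\Phi_S^*}R[q]/(f)$. A ring $R$ is $p$-adically separated if $\bigcap_{j\ge0}p^jR=(0)$. For $m,m'\in\mathbb{N}$ write $m\Leftrightarrow_R m'$ if $m=m'$, or $m/m'$ is an integer power (positive or negative exponent) of a prime $p$ with $R$ $p$-adically separated, or $R=\{0\}$. A subset $S\subset\mathbb{N}$ is $\Leftrightarrow_R$-connected if it is nonempty and any two elements are joined by a finite chain in $S$ with consecutive elements related by $\Leftrightarrow_R$.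 The map $\sigma^R_{S,\zeta}$ is well defined since $\Phi_n(q)$ is divisible by $q-\zeta$ in $R[\zeta][q]$ and the other generators become units in $R[\zeta][[q-\zeta]]$ (i.e. it is the map induced on completions). *)

theory Defs
  imports "HOL-Computational_Algebra.Computational_Algebra"
begin

(* Cyclotomic polynomials over Z, n >= 1, via  q^n - 1 = prod_{d | n} Phi_d(q).
   Phi_0 is set to 1 (it is never used: S consists of positive integers). *)
function cyclo :: "nat \<Rightarrow> int poly" where
  "cyclo n = (if n = 0 then 1
     else (monom 1 n - 1) div (\<Prod>d\<in>{d. d dvd n \<and> d < n}. cyclo d))"
  by auto
termination
  by (relation "measure id") auto

definition cyclo_mult_set :: "nat set \<Rightarrow> int poly set" where
  "cyclo_mult_set S = {\<Prod>m\<in>M. cyclo m ^ e m | M e. finite M \<and> M \<subseteq> S}"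

definition p_adically_separated :: "nat \<Rightarrow> 'a::comm_ring_1 itself \<Rightarrow> bool" where
  "p_adically_separated p _ \<longleftrightarrow> (\<forall>x::'a. (\<forall>j. (of_nat p :: 'a) ^ j dvd x) \<longrightarrow> x = 0)"

definition cyc_rel :: "'a::comm_ring_1 itself \<Rightarrow> nat \<Rightarrow> nat \<Rightarrow> bool" where
  "cyc_rel R m m' \<longleftrightarrow> m = m'
     \<or> (\<exists>p k. prime p \<and> p_adically_separated p R \<and> (m = m' * p ^ k \<or> m' = m * p ^ k))
     \<or> (UNIV :: 'a set) = {0}"

definition cyc_connected :: "'a::comm_ring_1 itself \<Rightarrow> nat set \<Rightarrow> bool" where
  "cyc_connected R S \<longleftrightarrow> S \<noteq> {} \<and>
     (\<forall>a\<in>S. \<forall>b\<in>S. (\<lambda>x y. x \<in> S \<and> y \<in> S \<and> cyc_rel R x y)\<^sup>*\<^sup>* a b)"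

(* Elements of R[q]^S = lim_{f in Phi_S^*} R[q]/(f), represented as compatible families
   g(f) in R[q] (a representative of the class in R[q]/(f)), f in Phi_S^*. *)
definition cyc_limit :: "nat set \<Rightarrow> (int poly \<Rightarrow> 'a::comm_ring_1 poly) set" where
  "cyc_limit S = {g. \<forall>f\<in>cyclo_mult_set S. \<forall>f'\<in>cyclo_mult_set S.
      f dvd f' \<longrightarrow> map_poly of_int f dvd (g f' - g f)}"

definition cyc_limit_eq :: "nat set \<Rightarrow> (int poly \<Rightarrow> 'a::comm_ring_1 poly) \<Rightarrow> (int poly \<Rightarrow> 'a poly) \<Rightarrow> bool" where
  "cyc_limit_eq S g h \<longleftrightarrow> (\<forall>f\<in>cyclo_mult_set S. map_poly of_int f dvd (g f - h f))"

definition prim_root :: "nat \<Rightarrow> 'b::field \<Rightarrow> bool" where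
  "prim_root n z \<longleftrightarrow> 0 < n \<and> z ^ n = 1 \<and> (\<forall>k. 0 < k \<and> k < n \<longrightarrow> z ^ k \<noteq> 1)"

(* sigma^R_{S,zeta}: R[q]^S -> R[zeta][[q - zeta]], where R is embedded in the field K
   via phi and zeta in K is a primitive n-th root of unity.  The i-th coefficient of the
   expansion in powers of (q - zeta) is read off from the component at Phi_n^(i+1),
   which determines the element modulo (q - zeta)^(i+1). *)
definition cyc_sigma :: "('a::comm_ring_1 \<Rightarrow> 'b::field) \<Rightarrow> nat \<Rightarrow> 'b \<Rightarrow> (int poly \<Rightarrow> 'a poly) \<Rightarrow> 'b fps" where
  "cyc_sigma \<phi> n z g = Abs_fps (\<lambda>i. coeff (pcompose (map_poly \<phi> (g (cyclo n ^ (i+1)))) [:z, 1:]) i)"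

definition ring_embedding :: "('a::comm_ring_1 \<Rightarrow> 'b::field) \<Rightarrow> bool" where
  "ring_embedding \<phi> \<longleftrightarrow> inj \<phi> \<and> \<phi> 0 = 0 \<and> \<phi> 1 = 1 \<and>
     (\<forall>x y. \<phi> (x + y) = \<phi> x + \<phi> y) \<and> (\<forall>x y. \<phi> (x * y) = \<phi> x * \<phi> y)"

end

theory Submission
  imports "HOL-Algebra.Algebraic_Closure_Type" Defs
begin

text \<open>
  Pass to an algebraic closure, where every cyclotomic polynomial splits into distinct linear factors,
  and ask whether an element \<open>D\<close> of the completion vanishes to all orders at a given root of unity.
  If \<open>a\<close> and \<open>b\<close> are roots of unity whose quotient has \<open>p\<close>-power order, then \<open>b - a\<close> is nilpotent
  modulo \<open>p\<close>. Modulo a fixed power of \<open>q - b\<close>, an element vanishing to all orders at \<open>a\<close> is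
  represented by multiples of \<open>(q - a)^K\<close> for arbitrarily large \<open>K\<close>, so its Taylor coefficients at
  \<open>b\<close> are divisible by every power of \<open>p\<close> in \<open>R[w]\<close>, for a root of unity \<open>w\<close> generating \<open>a\<close> and
  \<open>b\<close>. As \<open>R[w]\<close> inherits \<open>p\<close>-adic separatedness from \<open>R\<close>, \<open>D\<close> vanishes to all orders at \<open>b\<close> too.
  The hypotheses on \<open>n\<close> link all primitive \<open>n\<close>th roots of unity by such steps, and connectedness of
  \<open>S\<close> links them to the roots of every \<open>\<Phi>\<^sub>m\<close> with \<open>m \<in> S\<close>. Divisibility by all the linear factors
  then descends to divisibility by the monic polynomial \<open>f\<close> over \<open>R\<close>.
\<close>

declare cyclo.simps [simp del]

section \<open>Ring embeddings and their effect on polynomials\<close>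

lemma ring_embedding_simps:
  assumes "ring_embedding \<phi>"
  shows "\<phi> 0 = 0" "\<phi> 1 = 1" "\<phi> (x + y) = \<phi> x + \<phi> y" "\<phi> (x * y) = \<phi> x * \<phi> y"
    "\<phi> x = \<phi> y \<longleftrightarrow> x = y" "\<phi> x = 0 \<longleftrightarrow> x = 0"
    "\<phi> (- x) = - \<phi> x" "\<phi> (x - y) = \<phi> x - \<phi> y" "\<phi> (x ^ k) = \<phi> x ^ k"
    "\<phi> (of_nat k) = of_nat k" "\<phi> (of_int i) = of_int i"
proof -
  show 0: "\<phi> 0 = 0" and 1: "\<phi> 1 = 1" and add: "\<And>x y. \<phi> (x + y) = \<phi> x + \<phi> y"
    and mult: "\<And>x y. \<phi> (x * y) = \<phi> x * \<phi> y" and inj: "\<And>x y. \<phi> x = \<phi> y \<longleftrightarrow> x = y"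
    using assms by (auto simp: ring_embedding_def inj_def)
  show "\<phi> x = 0 \<longleftrightarrow> x = 0" using inj[of x 0] 0 by simp
  show minus: "\<phi> (- x) = - \<phi> x" for x
    using add[of x "- x"] 0 by (simp add: minus_unique)
  show "\<phi> (x - y) = \<phi> x - \<phi> y"
    using add[of x "- y"] minus by simp
  show "\<phi> (x ^ k) = \<phi> x ^ k" by (induction k) (auto simp: 1 mult)
  show of_nat: "\<phi> (of_nat k) = of_nat k" for k by (induction k) (auto simp: 0 1 add)
  show "\<phi> (of_int i) = of_int i" by (cases i) (auto simp: of_nat 1 add minus simp del: of_nat_Suc)
qed

lemma ring_embedding_sum:
  assumes "ring_embedding \<phi>"
  shows "\<phi> (sum f A) = (\<Sum>x\<in>A. \<phi> (f x))"
  by (induction A rule: infinite_finite_induct) (simp_all add: ring_embedding_simps[OF assms])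

lemma ring_embedding_map_poly:
  fixes \<phi> :: "'a::comm_ring_1 \<Rightarrow> 'b::field"
  assumes "ring_embedding \<phi>"
  shows "map_poly \<phi> (f + g) = map_poly \<phi> f + map_poly \<phi> g"
    "map_poly \<phi> (f - g) = map_poly \<phi> f - map_poly \<phi> g"
    "map_poly \<phi> (f * g) = map_poly \<phi> f * map_poly \<phi> g"
    "map_poly \<phi> (f ^ k) = map_poly \<phi> f ^ k"
    "map_poly \<phi> (smult c f) = smult (\<phi> c) (map_poly \<phi> f)"
    "coeff (map_poly \<phi> f) i = \<phi> (coeff f i)"
    "degree (map_poly \<phi> f) = degree f"
    "map_poly \<phi> f = map_poly \<phi> g \<longleftrightarrow> f = g"
    "map_poly \<phi> f = 0 \<longleftrightarrow> f = 0"
    "map_poly \<phi> (monom c i) = monom (\<phi> c) i"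
    "map_poly \<phi> 1 = 1"
    "map_poly \<phi> (map_poly of_int F) = map_poly of_int F"
proof -
  note e = ring_embedding_simps[OF assms]
  have c: "coeff (map_poly \<phi> f) i = \<phi> (coeff f i)" for f i
    by (simp add: coeff_map_poly e)
  show "coeff (map_poly \<phi> f) i = \<phi> (coeff f i)" by (rule c)
  show "map_poly \<phi> (f + g) = map_poly \<phi> f + map_poly \<phi> g"
    "map_poly \<phi> (f - g) = map_poly \<phi> f - map_poly \<phi> g"
    "map_poly \<phi> (smult c f) = smult (\<phi> c) (map_poly \<phi> f)"
    by (auto intro!: poly_eqI simp: c e)
  show m: "map_poly \<phi> (f * g) = map_poly \<phi> f * map_poly \<phi> g" for f g
    by (auto intro!: poly_eqI simp: c e coeff_mult ring_embedding_sum[OF assms])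
  show 1: "map_poly \<phi> 1 = 1" by (simp add: e)
  show "map_poly \<phi> (f ^ k) = map_poly \<phi> f ^ k"
    by (induction k) (simp_all only: m 1 power.simps)
  show "degree (map_poly \<phi> f) = degree f"
    by (cases "f = 0") (auto intro!: map_poly_degree_eq simp: e)
  show "map_poly \<phi> f = map_poly \<phi> g \<longleftrightarrow> f = g"
    by (auto simp: poly_eq_iff c e)
  show "map_poly \<phi> f = 0 \<longleftrightarrow> f = 0"
    by (auto simp: poly_eq_iff c e)
  show "map_poly \<phi> (monom c i) = monom (\<phi> c) i"
    by (rule map_poly_monom) (rule e)
  show "map_poly \<phi> (map_poly of_int F) = map_poly of_int F"
    by (subst map_poly_map_poly) (auto simp: e o_def)
qed

lemma ring_embedding_map_poly_prod:
  assumes "ring_embedding \<phi>"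
  shows "map_poly \<phi> (prod f A) = (\<Prod>x\<in>A. map_poly \<phi> (f x))"
  by (induction A rule: infinite_finite_induct)
     (simp_all add: ring_embedding_map_poly[OF assms] del: map_poly_1')

lemma ring_embedding_map_poly_dvd:
  assumes "ring_embedding \<phi>" "f dvd g"
  shows "map_poly \<phi> f dvd map_poly \<phi> g"
  using assms by (auto simp: dvd_def ring_embedding_map_poly)

lemma ring_embedding_map_poly_pcompose:
  assumes "ring_embedding \<phi>"
  shows "map_poly \<phi> (pcompose f g) = pcompose (map_poly \<phi> f) (map_poly \<phi> g)"
proof (induction f)
  case (pCons a f)
  then show ?case
    by (simp add: pcompose_pCons ring_embedding_map_poly[OF assms] map_poly_pCons
          ring_embedding_simps[OF assms])
qed simp

text \<open>Pseudo-division multiplies by a power of the leading coefficient, here 1, so division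
  with remainder stays over the base ring. The remainder has smaller degree than \<open>f\<close>,
  yet its image is a multiple of the image of \<open>f\<close>, so it is zero.\<close>

lemma monic_dvd_descent:
  fixes f g :: "'a::idom poly"
  assumes emb: "ring_embedding \<phi>" and monic: "lead_coeff f = 1"
    and dvd: "map_poly \<phi> f dvd map_poly \<phi> g"
  shows "f dvd g"
proof -
  note e = ring_embedding_map_poly[OF emb]
  have f: "f \<noteq> 0" using monic by auto
  obtain q r where qr: "pseudo_divmod g f = (q, r)" by force
  have eq: "g = f * q + r" and r: "r = 0 \<or> degree r < degree f"
    using pseudo_divmod[OF f qr] monic by simp_all
  have "map_poly \<phi> f dvd map_poly \<phi> r"
    using dvd unfolding eq e by (simp add: dvd_add_right_iff)
  have "r = 0"
  proof (rule ccontr)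
    assume "r \<noteq> 0"
    then have "degree (map_poly \<phi> f) \<le> degree (map_poly \<phi> r)"
      using \<open>map_poly \<phi> f dvd map_poly \<phi> r\<close> by (intro dvd_imp_degree_le) (auto simp: e)
    then show False using r \<open>r \<noteq> 0\<close> by (simp add: e)
  qed
  then show ?thesis using eq by simp
qed

lemma ring_embedding_of_int:
  assumes "CHAR('b::field) = 0"
  shows "ring_embedding (of_int :: int \<Rightarrow> 'b)"
proof -
  have "inj (of_int :: int \<Rightarrow> 'b)"
  proof (rule injI)
    fix x y :: int assume "(of_int x :: 'b) = of_int y"
    then have "(of_int (x - y) :: 'b) = 0" by simp
    then have "(of_nat (nat \<bar>x - y\<bar>) :: 'b) = 0"
      by (metis abs_minus_commute abs_of_nonneg abs_of_nonpos minus_zero nle_le of_int_minus of_nat_nat abs_ge_zero)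
    then have "nat \<bar>x - y\<bar> = 0" by (simp only: of_nat_eq_0_iff_char_dvd assms dvd_0_left_iff)
    then show "x = y" by simp
  qed
  then show ?thesis by (simp add: ring_embedding_def)
qed

lemma ring_embedding_CHAR:
  fixes \<phi> :: "'a::{comm_ring_1,ring_char_0} \<Rightarrow> 'b::field"
  assumes "ring_embedding \<phi>"
  shows "CHAR('b) = 0"
proof -
  have "(of_nat k :: 'b) \<noteq> 0" if "k > 0" for k
    using that ring_embedding_simps(6)[OF assms, of "of_nat k"] ring_embedding_simps(10)[OF assms, of k]
    by simp
  then show ?thesis by (simp add: CHAR_eq0_iff)
qed

section \<open>Primitive roots of unity\<close>

lemma prim_root_power_eq_1_iff:
  assumes "prim_root n z"
  shows "z ^ k = 1 \<longleftrightarrow> n dvd k"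
proof
  have n: "n > 0" "z ^ n = 1" and min: "\<And>k. 0 < k \<Longrightarrow> k < n \<Longrightarrow> z ^ k \<noteq> 1"
    using assms by (auto simp: prim_root_def)
  assume "z ^ k = 1"
  moreover have "z ^ k = (z ^ n) ^ (k div n) * z ^ (k mod n)"
    by (metis mult_div_mod_eq power_add power_mult)
  ultimately have "z ^ (k mod n) = 1" using n by simp
  then have "k mod n = 0" using min[of "k mod n"] n by (metis gr0I mod_less_divisor)
  then show "n dvd k" by auto
next
  assume "n dvd k"
  then show "z ^ k = 1" using assms by (auto simp: prim_root_def power_mult elim!: dvdE)
qed

lemma prim_rootI_dvd:
  assumes "n > 0" "\<And>k. z ^ k = 1 \<longleftrightarrow> n dvd k"
  shows "prim_root n z"
  using assms nat_dvd_not_less by (auto simp: prim_root_def)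

lemma prim_root_unique: "prim_root m z \<Longrightarrow> prim_root n z \<Longrightarrow> m = n"
  by (meson dvd_antisym dvd_refl prim_root_power_eq_1_iff)

lemma prim_root_nonzero: "prim_root n z \<Longrightarrow> z \<noteq> 0"
  by (auto simp: prim_root_def power_0_left)

lemma root_of_unity_imp_prim_root:
  fixes z :: "'b::field"
  assumes "z ^ n = 1" "n > 0"
  obtains d where "d dvd n" "prim_root d z"
proof -
  define d where "d = (LEAST d. d > 0 \<and> z ^ d = 1)"
  have d: "d > 0 \<and> z ^ d = 1" unfolding d_def by (rule LeastI[of _ n]) (use assms in auto)
  have "prim_root d z"
    using d not_less_Least[of _ "\<lambda>d. d > 0 \<and> z ^ d = 1"] by (auto simp: prim_root_def d_def)
  moreover from this have "d dvd n" using assms(1) prim_root_power_eq_1_iff by blast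
  ultimately show ?thesis using that by blast
qed

text \<open>If the order \<open>d\<close> of \<open>z\<close> were a proper divisor of
  \<open>n\<close>, a prime \<open>l\<close> dividing \<open>n div d\<close> would make
  \<open>d\<close> divide \<open>n div l\<close>. Primitivity can thus be tested one prime at a
  time.\<close>

lemma prim_rootI_prime:
  fixes z :: "'b::field"
  assumes "n > 0" "z ^ n = 1" "\<And>l. prime l \<Longrightarrow> l dvd n \<Longrightarrow> z ^ (n div l) \<noteq> 1"
  shows "prim_root n z"
proof -
  obtain d where d: "d dvd n" "prim_root d z"
    using root_of_unity_imp_prim_root assms by blast
  have "d = n"
  proof (rule ccontr)
    assume "d \<noteq> n"
    then obtain l where l: "prime l" "l dvd n div d"
      using d(1) assms(1) by (metis dvd_div_mult_self mult_1 prime_factor_nat)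
    then obtain c where "n div d = l * c" by blast
    then have "n = l * (d * c)" using d(1) by (metis dvd_mult_div_cancel mult.left_commute)
    then have "l dvd n" "d dvd n div l" using prime_gt_0_nat[OF l(1)] by simp_all
    then show False using l assms(3) d(2) prim_root_power_eq_1_iff by blast
  qed
  then show ?thesis using d by simp
qed

lemma finite_prim_roots: "finite {z::'b::field. prim_root n z}"
proof (cases "n = 0")
  case False
  then have "finite {z::'b. poly (monom 1 n - 1) z = 0}"
    by (intro poly_roots_finite) (simp add: monom_eq_1_iff)
  then show ?thesis
    by (rule rev_finite_subset) (auto simp: prim_root_def poly_monom)
qed (simp add: prim_root_def)

section \<open>Splitting of cyclotomic polynomials\<close>

text \<open>In characteristic 0 the derivative of q^n - 1 vanishes at most at 0, which is not a
  root. So all roots are simple and the multiset of roots is a set.\<close>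

lemma monom_minus_one_splits:
  fixes n :: nat
  assumes char: "CHAR('l::alg_closed_field) = 0" and n: "n > 0"
  shows "(monom 1 n - 1 :: 'l poly) = (\<Prod>z\<in>{z. z ^ n = 1}. [:-z, 1:])"
proof -
  define p where "p = (monom 1 n - 1 :: 'l poly)"
  have p0: "p \<noteq> 0" using n by (simp add: p_def monom_eq_1_iff)
  have coeffp: "coeff p i = (if i = n then 1 else 0) - (if i = 0 then 1 else 0)" for i
    by (auto simp: p_def)
  have "degree p = n"
    by (intro antisym degree_le le_degree) (use n in \<open>auto simp: coeffp\<close>)
  then have "lead_coeff p = 1" using n by (simp add: coeffp)
  then obtain A where A: "p = (\<Prod>x\<in>#A. [:-x, 1:])"
    using alg_closed_imp_factorization[OF p0] by auto
  have root: "poly p x = 0 \<longleftrightarrow> x ^ n = 1" for x by (simp add: p_def poly_monom)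
  have setA: "set_mset A = {z. z ^ n = 1}"
    unfolding root[symmetric] unfolding A by (auto simp: poly_prod_mset)
  have "count A x = 1" if x: "x \<in># A" for x
  proof (rule ccontr)
    assume "count A x \<noteq> 1"
    obtain B where B: "A = add_mset x B" using x by (metis multi_member_split)
    then have "x \<in># B" using \<open>count A x \<noteq> 1\<close> by (metis count_add_mset count_eq_zero_iff One_nat_def)
    then obtain C where C: "A = add_mset x (add_mset x C)" using B by (metis multi_member_split)
    have "p = [:-x, 1:] * ([:-x, 1:] * (\<Prod>x\<in>#C. [:-x, 1:]))"
      unfolding A C by simp
    then have "poly (pderiv p) x = 0" by (simp only: pderiv_mult poly_add poly_mult) simp
    moreover have "pderiv p = monom (of_nat n) (n - 1)"
      by (simp add: p_def pderiv_diff pderiv_monom)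
    ultimately have "(of_nat n :: 'l) * x ^ (n - 1) = 0" by (simp add: poly_monom)
    moreover have "x \<noteq> 0" using x setA n by (auto simp: power_0_left)
    ultimately show False using n char by (simp add: of_nat_eq_0_iff_char_dvd)
  qed
  then have "A = mset_set (set_mset A)"
    by (intro multiset_eqI) (metis count_eq_zero_iff count_mset_set(1,3) finite_set_mset)
  then have "p = (\<Prod>x\<in>set_mset A. [:-x, 1:])"
    unfolding A by (metis prod_unfold_prod_mset)
  then show ?thesis by (simp add: p_def setA)
qed

text \<open>Sorting the nth roots of unity by exact order splits q^n - 1 into one block per divisor
  of \<open>n\<close>. By induction the blocks of the proper divisors are known, and cancelling them
  leaves the block of order \<open>n\<close>.\<close>

lemma cyclo_splits:
  assumes char: "CHAR('l::alg_closed_field) = 0" and "n > 0"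
  shows "map_poly of_int (cyclo n) = (\<Prod>z\<in>{z::'l. prim_root n z}. [:-z, 1:])"
  using \<open>n > 0\<close>
proof (induction n rule: less_induct)
  case (less n)
  note emb = ring_embedding_of_int[OF char]
  note e = ring_embedding_map_poly[OF emb]
  let ?P = "\<lambda>d. \<Prod>z\<in>{z::'l. prim_root d z}. [:-z, 1:]"
  let ?D = "{d. d dvd n \<and> d < n}"
  define Q where "Q = (\<Prod>d\<in>?D. cyclo d)"
  have D: "{d. d dvd n} = insert n ?D" and fin: "finite ?D"
    using less.prems by (auto dest: dvd_imp_le)
  have un: "{z::'l. z ^ n = 1} = (\<Union>d\<in>{d. d dvd n}. {z. prim_root d z})"
  proof safe
    fix z :: 'l assume "z ^ n = 1"
    then show "z \<in> (\<Union>d\<in>{d. d dvd n}. {z. prim_root d z})"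
      using less.prems root_of_unity_imp_prim_root by blast
  next
    fix z :: 'l and d assume "d dvd n" "prim_root d z"
    then show "z ^ n = 1" using prim_root_power_eq_1_iff by blast
  qed
  have "(monom 1 n - 1 :: 'l poly) = (\<Prod>d\<in>{d. d dvd n}. ?P d)"
    unfolding monom_minus_one_splits[OF char less.prems] un
    by (rule prod.UNION_disjoint)
       (use less.prems finite_prim_roots prim_root_unique in \<open>auto simp: finite_divisors_nat\<close>)
  also have "\<dots> = ?P n * (\<Prod>d\<in>?D. ?P d)"
    unfolding D using fin by (subst prod.insert) auto
  also have map_Q: "(\<Prod>d\<in>?D. ?P d) = map_poly of_int Q"
    unfolding Q_def ring_embedding_map_poly_prod[OF emb]
    using less by (intro prod.cong) (auto intro: gr0I)
  finally have split: "(monom 1 n - 1 :: 'l poly) = ?P n * map_poly of_int Q" .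
  have "lead_coeff (map_poly of_int Q :: 'l poly) = 1"
    unfolding map_Q[symmetric] by (simp add: lead_coeff_prod)
  then have "(of_int (lead_coeff Q) :: 'l) = of_int 1" by (simp add: e)
  then have monic: "lead_coeff Q = 1" using ring_embedding_simps(5)[OF emb] by blast
  have mono: "map_poly of_int (monom 1 n - 1) = (monom 1 n - 1 :: 'l poly)" by (simp add: e)
  \<comment> \<open>Exactness of the \<open>div\<close> in the recursion for \<open>cyclo\<close>:
    the division succeeds over the closed field and descends to the integers because
    \<open>Q\<close> is monic.\<close>
  have "Q dvd monom 1 n - 1"
    using emb monic by (rule monic_dvd_descent) (unfold mono split, simp)
  then have "cyclo n * Q = monom 1 n - 1"
    using less.prems by (subst cyclo.simps) (simp add: Q_def)
  then have "map_poly of_int (cyclo n) * map_poly of_int Q = ?P n * map_poly of_int Q"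
    unfolding split[symmetric] mono[symmetric] by (simp only: e(3)[symmetric])
  moreover have "map_poly of_int Q \<noteq> (0 :: 'l poly)" using monic by (auto simp: e)
  ultimately show ?case by simp
qed

lemma lead_coeff_cyclo:
  assumes "n > 0"
  shows "lead_coeff (cyclo n) = 1"
proof -
  have char: "CHAR(complex) = 0" by simp
  note e = ring_embedding_map_poly[OF ring_embedding_of_int[OF char]]
  have "lead_coeff (map_poly of_int (cyclo n) :: complex poly) = 1"
    unfolding cyclo_splits[OF char assms] by (simp add: lead_coeff_prod)
  then show ?thesis by (simp add: e)
qed

lemma prim_root_complex:
  assumes "n > 0"
  shows "prim_root n (cis (2 * pi / real n))"
  unfolding prim_root_def
proof (intro conjI allI impI)
  show "0 < n" by fact
  show "cis (2 * pi / real n) ^ n = 1" using assms by (simp add: DeMoivre)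
  fix k assume k: "0 < k \<and> k < n"
  show "cis (2 * pi / real n) ^ k \<noteq> 1"
  proof
    assume "cis (2 * pi / real n) ^ k = 1"
    then have "cos (real k * (2 * pi / real n)) = 1"
      by (simp add: DeMoivre complex_eq_iff)
    then obtain i :: int where "real k * (2 * pi / real n) = real_of_int i * 2 * pi"
      unfolding cos_one_2pi_int by blast
    then have "real_of_int (int k) = real_of_int (i * int n)" using assms by (simp add: field_simps)
    then have "int k = i * int n" by (simp only: of_int_eq_iff)
    then have "int n dvd int k" by simp
    then show False using k nat_dvd_not_less by simp
  qed
qed

lemma degree_cyclo:
  assumes "CHAR('l::alg_closed_field) = 0" "n > 0"
  shows "degree (cyclo n) = card {z::'l. prim_root n z}"
proof -
  have "degree (cyclo n) = degree (map_poly of_int (cyclo n) :: 'l poly)"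
    by (simp add: ring_embedding_map_poly[OF ring_embedding_of_int[OF assms(1)]])
  also have "\<dots> = card {z::'l. prim_root n z}"
    unfolding cyclo_splits[OF assms] by (subst degree_prod_eq_sum_degree) auto
  finally show ?thesis .
qed

text \<open>The degree of a cyclotomic polynomial does not depend on the field over which it is split,
  and over the complex numbers it is visibly positive.\<close>
lemma prim_root_exists:
  assumes "CHAR('l::alg_closed_field) = 0" "n > 0"
  shows "\<exists>z::'l. prim_root n z"
proof -
  have "card {z::complex. prim_root n z} \<noteq> 0"
    using prim_root_complex[OF assms(2)] by (subst card_0_eq[OF finite_prim_roots]) blast
  then have "card {z::'l. prim_root n z} \<noteq> 0"
    using degree_cyclo[OF assms] degree_cyclo[where 'l = complex, OF _ assms(2)] by simp
  then have "{z::'l. prim_root n z} \<noteq> {}" by (metis card.empty)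
  then show ?thesis by blast
qed

section \<open>Powers of linear factors and Taylor coefficients\<close>

text \<open>Distinct linear polynomials are coprime: dividing out the power at \<open>b\<close>
  leaves the order of vanishing at every other \<open>c\<close> unchanged.\<close>

lemma prod_linear_powers_dvd:
  fixes f :: "'b::field poly"
  assumes "finite B" "\<And>b. b \<in> B \<Longrightarrow> [:-b, 1:] ^ e b dvd f"
  shows "(\<Prod>b\<in>B. [:-b, 1:] ^ e b) dvd f"
  using assms
proof (induction B arbitrary: f rule: finite_induct)
  case (insert b B)
  obtain g where g: "f = [:-b, 1:] ^ e b * g" using insert.prems by blast
  have "[:-c, 1:] ^ e c dvd g" if c: "c \<in> B" for c
  proof (cases "g = 0")
    case False
    have "c \<noteq> b" using c insert.hyps by auto
    then have "order c ([:-b, 1:] ^ e b) = 0" by (intro order_0I) simp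
    moreover have "f \<noteq> 0" using False by (simp add: g)
    ultimately have "order c f = order c g" unfolding g by (subst order_mult) auto
    moreover have "[:-c, 1:] ^ e c dvd f" using insert.prems c by blast
    ultimately show ?thesis using \<open>f \<noteq> 0\<close> by (simp add: order_divides)
  qed simp
  then have "(\<Prod>b\<in>B. [:-b, 1:] ^ e b) dvd g" by (rule insert.IH)
  then show ?case using insert.hyps by (simp add: g)
qed simp

lemma pcompose_power: "pcompose (f ^ k) g = pcompose f g ^ k"
  for f g :: "'a::comm_ring_1 poly"
  by (induction k) (simp_all add: pcompose_1 pcompose_mult)

text \<open>The substitution of q + a for q is invertible and carries q - a to q, and divisibility
  by a power of q is visible in the low coefficients. These are the Taylor coefficients at
  \<open>a\<close>.\<close>

lemma linear_power_dvd_iff_coeff: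
  fixes f :: "'b::field poly"
  shows "[:-a, 1:] ^ k dvd f \<longleftrightarrow> (\<forall>i<k. coeff (pcompose f [:a, 1:]) i = 0)"
proof -
  have "[:-a, 1:] ^ k dvd f \<longleftrightarrow> [:0, 1:] ^ k dvd pcompose f [:a, 1:]"
  proof
    assume "[:-a, 1:] ^ k dvd f"
    then obtain g where g: "f = [:-a, 1:] ^ k * g" by blast
    show "[:0, 1:] ^ k dvd pcompose f [:a, 1:]"
      by (simp add: g pcompose_mult pcompose_power pcompose_pCons)
  next
    assume "[:0, 1:] ^ k dvd pcompose f [:a, 1:]"
    then obtain g where g: "pcompose f [:a, 1:] = [:0, 1:] ^ k * g" by blast
    have "f = pcompose (pcompose f [:a, 1:]) [:-a, 1:]"
      by (simp add: pcompose_assoc[symmetric] pcompose_pCons)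
    also have "\<dots> = [:-a, 1:] ^ k * pcompose g [:-a, 1:]"
      by (simp add: g pcompose_mult pcompose_power pcompose_pCons)
    finally show "[:-a, 1:] ^ k dvd f" by simp
  qed
  then show ?thesis using monom_1_dvd_iff'[of k "pcompose f [:a, 1:]"] by (simp add: monom_altdef)
qed

section \<open>Arithmetic in R[w] modulo powers of a prime\<close>

text \<open>The ring R[w], with R the image of \<open>\<psi>\<close>. It is a set inside the field
  because \<open>w\<close> is chosen anew for each pair of roots of unity to be compared.\<close>

definition adjoin :: "('a::comm_ring_1 \<Rightarrow> 'l::field) \<Rightarrow> 'l \<Rightarrow> 'l set" where
  "adjoin \<psi> w = range (\<lambda>f. poly (map_poly \<psi> f) w)"

context
  fixes \<psi> :: "'a::{idom,ring_char_0} \<Rightarrow> 'l::alg_closed_field" and w :: 'l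
  assumes emb: "ring_embedding \<psi>"
begin

lemmas emb_simps = ring_embedding_simps[OF emb] ring_embedding_map_poly[OF emb]

lemma adjoinI: "x = poly (map_poly \<psi> f) w \<Longrightarrow> x \<in> adjoin \<psi> w"
  by (auto simp: adjoin_def)

lemma adjoin_add: "x \<in> adjoin \<psi> w \<Longrightarrow> y \<in> adjoin \<psi> w \<Longrightarrow> x + y \<in> adjoin \<psi> w"
  and adjoin_diff: "x \<in> adjoin \<psi> w \<Longrightarrow> y \<in> adjoin \<psi> w \<Longrightarrow> x - y \<in> adjoin \<psi> w"
  and adjoin_mult: "x \<in> adjoin \<psi> w \<Longrightarrow> y \<in> adjoin \<psi> w \<Longrightarrow> x * y \<in> adjoin \<psi> w"
proof -
  assume "x \<in> adjoin \<psi> w" "y \<in> adjoin \<psi> w"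
  then obtain f g where fg: "x = poly (map_poly \<psi> f) w" "y = poly (map_poly \<psi> g) w"
    by (auto simp: adjoin_def)
  show "x + y \<in> adjoin \<psi> w" by (rule adjoinI[of _ "f + g"]) (simp add: fg emb_simps)
  show "x - y \<in> adjoin \<psi> w" by (rule adjoinI[of _ "f - g"]) (simp add: fg emb_simps)
  show "x * y \<in> adjoin \<psi> w" by (rule adjoinI[of _ "f * g"]) (simp add: fg emb_simps)
qed

lemma adjoin_base: "\<psi> c \<in> adjoin \<psi> w"
  by (rule adjoinI[of _ "[:c:]"]) (simp add: map_poly_pCons emb_simps)

lemma adjoin_gen: "w \<in> adjoin \<psi> w"
  by (rule adjoinI[of _ "[:0, 1:]"]) (simp add: map_poly_pCons emb_simps)

lemma adjoin_of_int: "of_int i \<in> adjoin \<psi> w" and adjoin_of_nat: "of_nat k \<in> adjoin \<psi> w"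
  and adjoin_0: "0 \<in> adjoin \<psi> w" and adjoin_1: "1 \<in> adjoin \<psi> w"
  using adjoin_base[of "of_int i"] adjoin_base[of "of_nat k"] adjoin_base[of 0] adjoin_base[of 1]
  by (simp_all add: emb_simps)

lemma adjoin_power: "x \<in> adjoin \<psi> w \<Longrightarrow> x ^ k \<in> adjoin \<psi> w"
  by (induction k) (auto intro: adjoin_1 adjoin_mult)

lemma adjoin_sum: "(\<And>i. i \<in> I \<Longrightarrow> f i \<in> adjoin \<psi> w) \<Longrightarrow> sum f I \<in> adjoin \<psi> w"
  by (induction I rule: infinite_finite_induct) (auto intro: adjoin_0 adjoin_add)

lemmas adjoin_closed = adjoin_add adjoin_diff adjoin_mult adjoin_base adjoin_gen adjoin_of_int
  adjoin_of_nat adjoin_0 adjoin_1 adjoin_power adjoin_sum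

lemma adjoin_pcompose:
  assumes "\<And>i. coeff F i \<in> adjoin \<psi> w" "a \<in> adjoin \<psi> w"
  shows "coeff (pcompose F [:a, 1:]) i \<in> adjoin \<psi> w"
  using assms by (intro coeff_pcompose_semiring_closed)
    (auto intro: adjoin_closed simp: coeff_pCons split: nat.splits)

text \<open>Over the fraction field, \<open>w\<close> has a minimal polynomial \<open>P\<close>; clearing denominators, \<open>c^N R[w]\<close>
  lies in the free module on the powers of \<open>w\<close> below \<open>degree P\<close>, where \<open>c\<close> is the leading
  coefficient of \<open>P\<close>, and there separatedness can be checked coefficientwise.\<close>
lemma adjoin_p_adically_separated:
  assumes w: "prim_root N w" and sep: "p_adically_separated p TYPE('a)"
    and dvd: "\<And>j. \<exists>y\<in>adjoin \<psi> w. x = of_nat p ^ j * y"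
  shows "x = 0"
proof -
  define M :: "'a poly" where "M = monom 1 N - 1"
  have N: "N > 0" "w ^ N = 1" using w by (auto simp: prim_root_def)
  have coeffM: "coeff M i = (if i = N then 1 else 0) - (if i = 0 then 1 else 0)" for i
    by (auto simp: M_def)
  have degM: "degree M = N"
    by (intro antisym degree_le le_degree) (use N in \<open>auto simp: coeffM\<close>)
  have monicM: "lead_coeff M = 1" and M0: "M \<noteq> 0" using N by (auto simp: coeffM degM poly_eq_iff)
  have rootM: "poly (map_poly \<psi> M) w = 0" by (simp add: M_def emb_simps poly_monom N)
  define V where "V = (\<lambda>P. P \<noteq> 0 \<and> poly (map_poly \<psi> P) w = 0)"
  \<comment> \<open>Least degree is taken among polynomials over R itself, so \<open>P\<close> need
    not be monic; \<open>M\<close> shows that a candidate exists.\<close>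
  define P where "P = arg_min degree V"
  have "V M" using M0 rootM by (simp add: V_def)
  then have "V P" and min: "\<And>Q. V Q \<Longrightarrow> degree P \<le> degree Q"
    unfolding P_def using arg_min_nat_lemma[of V M degree] by auto
  then have P: "P \<noteq> 0" "poly (map_poly \<psi> P) w = 0" by (auto simp: V_def)
  have degP: "degree P > 0"
  proof (rule gr0I)
    assume "degree P = 0"
    then obtain a where "P = [:a:]" by (auto elim: degree_eq_zeroE)
    then show False using P by (simp add: map_poly_pCons emb_simps)
  qed
  define c where "c = lead_coeff P"
  have c: "c \<noteq> 0" using P by (simp add: c_def)
  \<comment> \<open>Dividing by the monic \<open>M\<close> costs no factor and bounds the degree
    below \<open>N\<close>; pseudo-dividing by \<open>P\<close> then costs at most
    \<open>c ^ N\<close>. The exponent must not depend on \<open>y\<close>, since one power has to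
    serve \<open>x\<close> and all its quotients by powers of \<open>p\<close>.\<close>
  have reduce: "\<exists>r. degree r < degree P \<and> \<psi> c ^ N * y = poly (map_poly \<psi> r) w"
    if "y \<in> adjoin \<psi> w" for y
  proof -
    obtain f where f: "y = poly (map_poly \<psi> f) w" using \<open>y \<in> adjoin \<psi> w\<close> by (auto simp: adjoin_def)
    obtain q f' where qf: "pseudo_divmod f M = (q, f')" by force
    have eq: "f = M * q + f'" and f': "f' = 0 \<or> degree f' < N"
      using pseudo_divmod[OF M0 qf] monicM degM by simp_all
    have y: "y = poly (map_poly \<psi> f') w" unfolding f eq by (simp add: emb_simps rootM)
    obtain q' r where qr: "pseudo_divmod f' P = (q', r)" by force
    define k where "k = Suc (degree f') - degree P"
    have eq': "smult (c ^ k) f' = P * q' + r" and r: "r = 0 \<or> degree r < degree P"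
      using pseudo_divmod[OF P(1) qr] by (simp_all add: c_def k_def)
    have "\<psi> c ^ k * y = poly (map_poly \<psi> (smult (c ^ k) f')) w"
      by (simp add: emb_simps y)
    also have "\<dots> = poly (map_poly \<psi> r) w"
      unfolding eq' by (simp add: emb_simps P(2))
    finally have "\<psi> c ^ (N - k) * (\<psi> c ^ k * y) = poly (map_poly \<psi> (smult (c ^ (N - k)) r)) w"
      by (simp add: emb_simps)
    moreover have "k \<le> N" using f' N degP by (auto simp: k_def)
    ultimately have "\<psi> c ^ N * y = poly (map_poly \<psi> (smult (c ^ (N - k)) r)) w"
      by (simp flip: mult.assoc power_add)
    moreover have "degree (smult (c ^ (N - k)) r) < degree P"
      using r degP c by auto
    ultimately show ?thesis by blast
  qed
  \<comment> \<open>By minimality the powers of \<open>w\<close> below \<open>degree P\<close> are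
    independent over R, so an equation between values becomes one between coefficients.\<close>
  have unique: "r = s" if "degree r < degree P" "degree s < degree P"
    "poly (map_poly \<psi> r) w = poly (map_poly \<psi> s) w" for r s
  proof (rule ccontr)
    assume "r \<noteq> s"
    then have "V (r - s)" using that(3) by (simp add: V_def emb_simps)
    then have "degree P \<le> degree (r - s)" by (rule min)
    then show False using degree_diff_less[OF that(1,2)] by simp
  qed
  have "x \<in> adjoin \<psi> w" using dvd[of 0] by auto
  then obtain r where r: "degree r < degree P" "\<psi> c ^ N * x = poly (map_poly \<psi> r) w"
    using reduce by blast
  have "of_nat p ^ j dvd coeff r i" for i j
  proof -
    obtain y where y: "y \<in> adjoin \<psi> w" "x = of_nat p ^ j * y" using dvd by blast
    obtain s where s: "degree s < degree P" "\<psi> c ^ N * y = poly (map_poly \<psi> s) w"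
      using reduce y by blast
    have "poly (map_poly \<psi> r) w = of_nat p ^ j * (\<psi> c ^ N * y)"
      unfolding r(2)[symmetric] y(2) by simp
    also have "\<dots> = poly (map_poly \<psi> (smult (of_nat p ^ j) s)) w"
      by (simp add: s(2) emb_simps)
    finally have "r = smult (of_nat p ^ j) s"
      using r(1) s(1) by (intro unique) (auto intro: le_less_trans[OF degree_smult_le])
    then show ?thesis by simp
  qed
  then have "r = 0" using sep by (auto simp: p_adically_separated_def poly_eq_iff)
  then show "x = 0" using r(2) c by (simp add: emb_simps)
qed

text \<open>The inner binomial coefficients are multiples of \<open>p\<close>. The congruence is
  proved for integer polynomials and then evaluated at \<open>u\<close>, which keeps the error term
  in R[w].\<close>

lemma adjoin_frobenius:
  assumes u: "u \<in> adjoin \<psi> w" and p: "prime p"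
  obtains y where "y \<in> adjoin \<psi> w" "(u - 1) ^ p = u ^ p - 1 + of_nat p * y"
proof -
  let ?F = "[:-1, 1:] ^ p - (monom 1 p - 1) :: int poly"
  have "int p dvd coeff ?F i" for i
  proof (cases "i \<le> p")
    case True
    have c: "coeff ([:-1, 1:] ^ p :: int poly) i = int (p choose i) * (-1) ^ (p - i)"
      using coeff_linear_poly_power[OF True, of "-1::int" 1] by simp
    consider "i = p" | "i = 0" | "0 < i" "i < p" using True by linarith
    then show ?thesis
    proof cases
      case 1
      then show ?thesis using prime_gt_0_nat[OF p] by (simp add: coeff_linear_power)
    next
      \<comment> \<open>The constant coefficient of \<open>?F\<close> is (-1)^p + 1: zero for odd
        \<open>p\<close>, and 2 for \<open>p = 2\<close>.\<close>
      case 2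
      then show ?thesis using prime_odd_nat[OF p] prime_gt_1_nat[OF p] c
        by (cases "p = 2") (auto simp: prime_gt_0_nat[OF p])
    next
      case 3
      then have "p dvd p choose i" using p by (intro dvd_choose_prime) auto
      then show ?thesis using 3 by (simp add: c)
    qed
  next
    case False
    then show ?thesis by (simp add: coeff_eq_0 degree_linear_power)
  qed
  then have "[:int p:] dvd ?F" by (simp only: const_poly_dvd_iff) simp
  then obtain Y where "?F = [:int p:] * Y" by blast
  then have Y: "[:-1, 1:] ^ p = monom 1 p - 1 + smult (int p) Y" by (simp add: algebra_simps)
  note oi = ring_embedding_map_poly[OF ring_embedding_of_int[OF ring_embedding_CHAR[OF emb]]]
  have "map_poly of_int [:-1, 1:] ^ p = (map_poly of_int ([:-1, 1:] ^ p) :: 'l poly)"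
    by (simp only: oi)
  also have "\<dots> = monom 1 p - 1 + smult (of_nat p) (map_poly of_int Y)"
    unfolding Y by (simp add: oi)
  finally have "map_poly of_int [:-1, 1:] ^ p =
      monom 1 p - 1 + smult (of_nat p) (map_poly of_int Y :: 'l poly)" .
  then have "poly (map_poly of_int [:-1, 1:] ^ p) u =
      u ^ p - 1 + of_nat p * poly (map_poly of_int Y) u"
    by (simp add: poly_monom)
  then have "(u - 1) ^ p = u ^ p - 1 + of_nat p * poly (map_poly of_int Y) u"
    by (simp add: map_poly_pCons)
  moreover have "poly (map_poly of_int Y) u \<in> adjoin \<psi> w"
    unfolding poly_altdef by (intro adjoin_closed u) (simp add: coeff_map_poly adjoin_of_int)
  ultimately show ?thesis using that by blast
qed

text \<open>Modulo \<open>p\<close>, the power (u - 1)^p agrees with u^p - 1, and the induction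
  hypothesis for u^p makes some power of the latter divisible by \<open>p\<close>.\<close>

lemma adjoin_unipotent:
  assumes "u \<in> adjoin \<psi> w" "prime p" "u ^ (p ^ t) = 1"
  shows "\<exists>M. \<exists>y\<in>adjoin \<psi> w. (u - 1) ^ M = of_nat p * y"
  using assms(1,3)
proof (induction t arbitrary: u)
  \<comment> \<open>Here \<open>u = 1\<close>. The exponent is 1 and not 0, since a zeroth power is
    1 even at 0.\<close>
  case 0
  then show ?case by (intro exI[of _ 1] bexI[of _ 0]) (auto intro: adjoin_0)
next
  case (Suc t)
  obtain z where z: "z \<in> adjoin \<psi> w" "(u - 1) ^ p = u ^ p - 1 + of_nat p * z"
    using adjoin_frobenius[OF Suc.prems(1) assms(2)] by blast
  have "(u ^ p) ^ (p ^ t) = 1" using Suc.prems by (simp flip: power_mult)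
  then obtain M y where y: "y \<in> adjoin \<psi> w" "(u ^ p - 1) ^ M = of_nat p * y"
    using Suc.IH[of "u ^ p"] Suc.prems adjoin_power by blast
  \<comment> \<open>A congruence modulo \<open>p\<close> in R[w] persists under \<open>k\<close>th
    powers.\<close>
  have "\<exists>v\<in>adjoin \<psi> w. (u ^ p - 1 + of_nat p * z) ^ k = (u ^ p - 1) ^ k + of_nat p * v" for k
  proof (induction k)
    case (Suc k)
    then obtain v where v: "v \<in> adjoin \<psi> w"
      "(u ^ p - 1 + of_nat p * z) ^ k = (u ^ p - 1) ^ k + of_nat p * v" by blast
    show ?case
      by (rule bexI[of _ "(u ^ p - 1) * v + z * (u ^ p - 1) ^ k + of_nat p * (z * v)"])
        (use v \<open>u \<in> adjoin \<psi> w\<close> z in \<open>auto intro!: adjoin_closed simp: algebra_simps\<close>)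
  qed (auto intro!: bexI[of _ 0] adjoin_0)
  then obtain v where v: "v \<in> adjoin \<psi> w" "(u - 1) ^ (p * M) = (u ^ p - 1) ^ M + of_nat p * v"
    unfolding power_mult z(2) by blast
  then show ?case using y
    by (intro exI[of _ "p * M"] bexI[of _ "y + v"]) (auto intro: adjoin_add simp: algebra_simps)
qed

text \<open>Write \<open>F\<close> as (q - a)^K times a cofactor and expand q - a as (b - a) + (q -
  b). A term in (q - b)^i uses at most \<open>i\<close> factors q - b from the \<open>K\<close>th
  power, so at least \<open>K - i\<close> factors \<open>b - a\<close> remain.\<close>

lemma coeff_pcompose_shift:
  assumes F: "\<And>i. coeff F i \<in> adjoin \<psi> w" and ab: "a \<in> adjoin \<psi> w" "b \<in> adjoin \<psi> w"
    and dvd: "[:-a, 1:] ^ K dvd F" and i: "i \<le> K"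
  shows "\<exists>y\<in>adjoin \<psi> w. coeff (pcompose F [:b, 1:]) i = (b - a) ^ (K - i) * y"
proof -
  define G where "G = pcompose F [:a, 1:]"
  have "monom 1 K dvd G"
    using dvd by (simp add: linear_power_dvd_iff_coeff monom_1_dvd_iff' G_def)
  then obtain H where H: "G = monom 1 K * H" by blast
  have "coeff H j \<in> adjoin \<psi> w" for j
  proof -
    have "coeff H j = coeff G (j + K)" by (simp add: H coeff_monom_mult)
    then show ?thesis using adjoin_pcompose[OF F ab(1)] by (simp add: G_def)
  qed
  then have H': "coeff (pcompose H [:b - a, 1:]) j \<in> adjoin \<psi> w" for j
    using ab by (intro adjoin_pcompose adjoin_diff)
  have "pcompose F [:b, 1:] = pcompose G [:b - a, 1:]"
    by (simp add: G_def pcompose_assoc[symmetric] pcompose_pCons)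
  also have "\<dots> = [:b - a, 1:] ^ K * pcompose H [:b - a, 1:]"
    by (simp add: H pcompose_mult monom_altdef pcompose_power pcompose_pCons)
  finally have "coeff (pcompose F [:b, 1:]) i = (\<Sum>l\<le>i. of_nat (K choose l) * (b - a) ^ (K - l)
      * coeff (pcompose H [:b - a, 1:]) (i - l))"
    using i by (simp add: coeff_mult coeff_linear_poly_power)
  also have "\<dots> = (\<Sum>l\<le>i. (b - a) ^ (K - i) * (of_nat (K choose l) * (b - a) ^ (i - l)
      * coeff (pcompose H [:b - a, 1:]) (i - l)))"
  proof (rule sum.cong, simp)
    fix l assume "l \<in> {..i}"
    then have "(b - a) ^ (K - l) = (b - a) ^ (K - i) * (b - a) ^ (i - l)"
      using i by (simp flip: power_add)
    then show "of_nat (K choose l) * (b - a) ^ (K - l) * coeff (pcompose H [:b - a, 1:]) (i - l) =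
      (b - a) ^ (K - i) * (of_nat (K choose l) * (b - a) ^ (i - l)
      * coeff (pcompose H [:b - a, 1:]) (i - l))" by (simp add: mult_ac)
  qed
  also have "\<dots> = (b - a) ^ (K - i) * (\<Sum>l\<le>i. of_nat (K choose l) * (b - a) ^ (i - l)
      * coeff (pcompose H [:b - a, 1:]) (i - l))" by (simp add: sum_distrib_left)
  finally show ?thesis
    by (rule bexI) (intro adjoin_closed ab H')
qed

text \<open>The order \<open>k\<close> at \<open>b\<close> stays fixed while the order
  \<open>K\<close> at \<open>a\<close> grows. For every \<open>K\<close> the first \<open>k\<close>
  Taylor coefficients of \<open>G\<close> at \<open>b\<close> are those of some \<open>F\<close>
  over R, so they acquire arbitrarily many factors \<open>p\<close>.\<close>

lemma vanishing_transfer: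
  assumes w: "prim_root N w" and p: "prime p" and sep: "p_adically_separated p TYPE('a)"
    and ab: "a \<in> adjoin \<psi> w" "b \<in> adjoin \<psi> w" "a ^ N = 1" "a ^ (p ^ t) = b ^ (p ^ t)"
    and approx: "\<And>K. \<exists>F. [:-a, 1:] ^ K dvd map_poly \<psi> F \<and> [:-b, 1:] ^ k dvd map_poly \<psi> F - G"
  shows "[:-b, 1:] ^ k dvd G"
  unfolding linear_power_dvd_iff_coeff
proof (intro allI impI)
  fix i assume i: "i < k"
  \<comment> \<open>The quotient of \<open>b\<close> by \<open>a\<close>, written without division
    so that it visibly lies in R[w].\<close>
  define u where "u = b * a ^ (N - 1)"
  have N: "N > 0" using w by (simp add: prim_root_def)
  have ua: "u * a = b" using ab(3) N by (simp add: u_def mult.assoc flip: power_Suc2)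
  have a0: "a \<noteq> 0" using ab(3) N by (auto simp: power_0_left)
  have "u ^ (p ^ t) * a ^ (p ^ t) = a ^ (p ^ t)"
    unfolding power_mult_distrib[symmetric] ua by (rule ab(4)[symmetric])
  then have "u ^ (p ^ t) = 1" using a0 by simp
  moreover have u: "u \<in> adjoin \<psi> w" unfolding u_def by (intro adjoin_closed ab)
  ultimately obtain M y where y: "y \<in> adjoin \<psi> w" "(u - 1) ^ M = of_nat p * y"
    using adjoin_unipotent p by blast
  have ba: "b - a = a * (u - 1)" by (simp add: algebra_simps flip: ua)
  have M: "(b - a) ^ M = of_nat p * (a ^ M * y)" by (simp add: ba power_mult_distrib y mult_ac)
  show "coeff (pcompose G [:b, 1:]) i = 0"
  proof (rule adjoin_p_adically_separated[OF w sep])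
    fix j
    \<comment> \<open>As \<open>i < k\<close>, at least \<open>M * j\<close> factors
      \<open>b - a\<close> are left, and each block of \<open>M\<close> of them yields one factor
      \<open>p\<close>.\<close>
    define K where "K = M * j + k"
    obtain F where F: "[:-a, 1:] ^ K dvd map_poly \<psi> F" "[:-b, 1:] ^ k dvd map_poly \<psi> F - G"
      using approx by blast
    have "coeff (pcompose (map_poly \<psi> F) [:b, 1:]) i = coeff (pcompose G [:b, 1:]) i"
      using F(2) i by (simp add: linear_power_dvd_iff_coeff pcompose_diff)
    moreover obtain z where z: "z \<in> adjoin \<psi> w"
      "coeff (pcompose (map_poly \<psi> F) [:b, 1:]) i = (b - a) ^ (K - i) * z"
      using coeff_pcompose_shift[OF _ ab(1,2) F(1), of i] i adjoin_base
      by (auto simp: emb_simps K_def)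
    moreover have "(b - a) ^ (K - i) = of_nat p ^ j * ((a ^ M * y) ^ j * (b - a) ^ (k - i))"
    proof -
      have "K - i = M * j + (k - i)" using i by (simp add: K_def)
      then show ?thesis by (simp add: power_add power_mult M power_mult_distrib mult_ac)
    qed
    ultimately have "coeff (pcompose G [:b, 1:]) i =
        of_nat p ^ j * (((a ^ M * y) ^ j * (b - a) ^ (k - i)) * z)" by (simp add: mult_ac)
    then show "\<exists>y\<in>adjoin \<psi> w. coeff (pcompose G [:b, 1:]) i = of_nat p ^ j * y"
      by (rule bexI) (intro adjoin_closed ab y z)
  qed
qed

end

section \<open>Chains of roots of unity with quotients of prime-power order\<close>

text \<open>Primitivity makes the first \<open>N\<close> powers of \<open>w\<close> distinct, and
  q^N - 1 has at most \<open>N\<close> roots, so these powers exhaust them.\<close>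

lemma root_of_unity_power_prim_root:
  fixes z w :: "'b::field"
  assumes w: "prim_root N w" and z: "z ^ N = 1"
  obtains i where "z = w ^ i"
proof -
  let ?p = "monom 1 N - 1 :: 'b poly"
  have N: "N > 0" "w ^ N = 1" using w by (auto simp: prim_root_def)
  have p0: "?p \<noteq> 0" using N by (simp add: monom_eq_1_iff)
  have R: "{x. poly ?p x = 0} = {x. x ^ N = 1}" by (simp add: poly_monom)
  have fin: "finite {x::'b. x ^ N = 1}" using poly_roots_finite[OF p0] unfolding R .
  have "inj_on (\<lambda>i. w ^ i) {..<N}"
  proof (rule linorder_inj_onI)
    fix i j assume ij: "i < j" "i \<in> {..<N}" "j \<in> {..<N}"
    have "\<not> N dvd j - i" using ij by (intro nat_dvd_not_less) auto
    then have "w ^ (j - i) \<noteq> 1" using prim_root_power_eq_1_iff[OF w] by simp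
    moreover have "w ^ j = w ^ i * w ^ (j - i)" using ij by (simp flip: power_add)
    ultimately show "w ^ i \<noteq> w ^ j" using prim_root_nonzero[OF w] by simp
  qed auto
  then have "card ((\<lambda>i. w ^ i) ` {..<N}) = N" by (simp add: card_image)
  moreover have "card {x::'b. x ^ N = 1} \<le> N"
  proof -
    have "degree ?p \<le> N" by (intro degree_diff_le degree_monom_le) simp
    then show ?thesis using card_poly_roots_bound[OF p0] unfolding R by simp
  qed
  moreover have sub: "(\<lambda>i. w ^ i) ` {..<N} \<subseteq> {x. x ^ N = 1}"
  proof safe
    fix i show "(w ^ i) ^ N = 1" using N by (metis power_commutes power_mult mult.commute power_one)
  qed
  ultimately have "(\<lambda>i. w ^ i) ` {..<N} = {x. x ^ N = 1}"
    using fin by (intro card_seteq) auto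
  then show ?thesis using z that by blast
qed

text \<open>The quotient of \<open>b\<close> by \<open>a\<close> has order dividing
  \<open>d\<close>. Splitting off its \<open>p\<close>-primary part for one prime at a time gives a
  chain from \<open>a\<close> to \<open>b\<close>; the work lies in keeping each intermediate root
  primitive. \<open>V\<close> and \<open>sep\<close> are abstract because only orders of roots
  matter here.\<close>

lemma prim_roots_connected:
  fixes a b :: "'b::field"
  assumes step: "\<And>p t a b. prime p \<Longrightarrow> sep p \<Longrightarrow> prim_root n a \<Longrightarrow> prim_root n b \<Longrightarrow>
      a ^ (p ^ t) = b ^ (p ^ t) \<Longrightarrow> V a \<Longrightarrow> V b"
    and odd_sep: "\<And>p. prime p \<Longrightarrow> odd p \<Longrightarrow> p dvd n \<Longrightarrow> sep p"
    and two_sep: "4 dvd n \<Longrightarrow> sep (2::nat)"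
    and "d dvd n" "prim_root n a" "prim_root n b" "a ^ d = b ^ d" "V a"
  shows "V b"
  using assms(4-)
proof (induction d arbitrary: a rule: less_induct)
  case (less d)
  note a = \<open>prim_root n a\<close> and b = \<open>prim_root n b\<close>
  have n: "n > 0" using a by (simp add: prim_root_def)
  then have d0: "d > 0" using \<open>d dvd n\<close> by (auto intro: gr0I)
  show ?case
  proof (cases "d = 1")
    case True
    then show ?thesis using less.prems by simp
  next
    case False
    then obtain p where p: "prime p" "p dvd d" using prime_factor_nat by blast
    have p1: "p > 1" using p prime_gt_1_nat by blast
    obtain d' where d': "d = p ^ multiplicity p d * d'" "\<not> p dvd d'"
      using multiplicity_decompose'[of d p] d0 p1 by auto
    define k where "k = multiplicity p d"
    have k: "k > 0" using p d0 p1 by (auto simp: k_def multiplicity_gt_zero_iff)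
    have d: "d = p ^ k * d'" using d' by (simp add: k_def)
    have "coprime d' (p ^ k)" using prime_imp_coprime[OF p(1) d'(2)]
      by (simp add: coprime_commute)
    moreover have d'0: "d' \<noteq> 0" using d d0 by auto
    ultimately obtain x y where xy: "d' * x = p ^ k * y + 1"
      using bezout_nat[of d' "p ^ k"] by (auto simp: coprime_iff_gcd_eq_1)
    have a0: "a \<noteq> 0" using a by (rule prim_root_nonzero)
    define u where "u = b / a"
    have u: "u ^ d = 1" and b_eq: "b = a * u"
      using less.prems(4) a0 by (simp_all add: u_def power_divide flip: less.prems(4))
    \<comment> \<open>The exponent \<open>d' * x\<close> is 0 modulo \<open>d'\<close> and 1 modulo
      \<open>p ^ k\<close>, so it projects \<open>u\<close> to its \<open>p\<close>-primary part.
      Thus \<open>c\<close> corrects exactly the \<open>p\<close>-part of the discrepancy between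
      \<open>a\<close> and \<open>b\<close>.\<close>
    define c where "c = a * u ^ (d' * x)"
    have c_b: "c = b * u ^ (p ^ k * y)" by (simp add: c_def b_eq xy)
    have c_pk: "c ^ (p ^ k) = a ^ (p ^ k)"
    proof -
      have "(u ^ (d' * x)) ^ (p ^ k) = (u ^ d) ^ x"
        by (simp add: d mult_ac flip: power_mult)
      then show ?thesis by (simp add: c_def power_mult_distrib u)
    qed
    have c_d': "c ^ d' = b ^ d'"
    proof -
      have "(u ^ (p ^ k * y)) ^ d' = (u ^ d) ^ y"
        by (simp add: d mult_ac flip: power_mult)
      then show ?thesis by (simp add: c_b power_mult_distrib u)
    qed
    have c_mult: "c ^ (p ^ k * e) = a ^ (p ^ k * e)" "c ^ (d' * e) = b ^ (d' * e)" for e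
      by (simp_all add: power_mult c_pk c_d')
    obtain m where m: "n = p ^ k * d' * m" using \<open>d dvd n\<close> d by blast
    \<comment> \<open>For a prime \<open>l\<close> the exponent \<open>n div l\<close> is a multiple
      of \<open>d'\<close> if \<open>l = p\<close>, and of \<open>p ^ k\<close> otherwise. There
      \<open>c\<close> has the same power as \<open>b\<close> or \<open>a\<close>, respectively, and
      that power is not 1.\<close>
    have c: "prim_root n c"
    proof (rule prim_rootI_prime)
      show "n > 0" by fact
      show "c ^ n = 1" using c_mult(1)[of "d' * m"] a by (simp add: m prim_root_def mult.assoc)
      fix l assume l: "prime l" "l dvd n"
      have l0: "l > 0" using l prime_gt_0_nat by blast
      have "0 < n div l" using n l0 l(2) by (simp add: div_greater_zero_iff dvd_imp_le)
      moreover have "n div l < n" using n prime_gt_1_nat[OF l(1)] by simp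
      ultimately have ndvd: "\<not> n dvd n div l" by (rule nat_dvd_not_less)
      show "c ^ (n div l) \<noteq> 1"
      proof (cases "l = p")
        case True
        have "n = p * (d' * (p ^ (k - 1) * m))"
          using k by (simp add: m mult_ac flip: power_Suc)
        then have "n div l = d' * (p ^ (k - 1) * m)" using True l0 by simp
        then have "c ^ (n div l) = b ^ (n div l)" by (simp only: c_mult)
        then show ?thesis using ndvd prim_root_power_eq_1_iff[OF b] by simp
      next
        case False
        then have "\<not> l dvd p ^ k"
          using l p primes_dvd_imp_eq prime_dvd_power by blast
        then have "l dvd d' * m" using l prime_dvd_mult_iff[OF l(1), of "p ^ k" "d' * m"]
          by (simp add: m mult.assoc)
        then obtain e where "d' * m = l * e" by blast
        then have "n = l * (p ^ k * e)" by (simp add: m mult.assoc mult.left_commute)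
        then have "n div l = p ^ k * e" using l0 by simp
        then have "c ^ (n div l) = a ^ (n div l)" by (simp only: c_mult)
        then show ?thesis using ndvd prim_root_power_eq_1_iff[OF a] by simp
      qed
    qed
    have "p dvd n" using p \<open>d dvd n\<close> dvd_trans by blast
    have "V c"
    proof (cases "p = 2 \<and> \<not> 4 dvd n")
      case False
      then have "sep p"
        using odd_sep two_sep p(1) \<open>p dvd n\<close> prime_odd_nat[OF p(1)] p1 by (cases "p = 2") auto
      then show ?thesis using step[OF p(1) _ a c c_pk[symmetric] \<open>V a\<close>] by blast
    next
      case True
      \<comment> \<open>If \<open>2\<close> divides \<open>n\<close> exactly once, then \<open>a\<close> and \<open>-a\<close> are not both primitive, so no step
        at \<open>2\<close> occurs.\<close>
      obtain h where h: "n = 2 * h" using True \<open>p dvd n\<close> by blast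
      then have "odd h" using True by auto
      have "k = 1"
      proof (rule ccontr)
        assume "k \<noteq> 1"
        then have "2 \<le> k" using k by simp
        then have "2 ^ 2 dvd p ^ k" using True le_imp_power_dvd by blast
        then have "4 dvd n" unfolding m by simp
        then show False using True by blast
      qed
      then have "c ^ 2 = a ^ 2" using c_pk True by simp
      moreover have "c \<noteq> - a"
      proof
        assume "c = - a"
        \<comment> \<open>\<open>a ^ h\<close> is a square root of 1 other than 1, hence -1; as
          \<open>h\<close> is odd, \<open>(- a) ^ h\<close> would then be 1, against the primitivity
          of \<open>c\<close>.\<close>
        have "\<not> n dvd h" using h n by (auto dest: dvd_imp_le)
        then have "a ^ h \<noteq> 1" "c ^ h \<noteq> 1"
          using prim_root_power_eq_1_iff[OF a] prim_root_power_eq_1_iff[OF c] by simp_all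
        moreover have "(a ^ h) ^ 2 = 1"
          unfolding power_mult[symmetric] prim_root_power_eq_1_iff[OF a] using h by simp
        ultimately show False using \<open>c = - a\<close> \<open>odd h\<close> by (auto simp: power2_eq_1_iff)
      qed
      ultimately show ?thesis using \<open>V a\<close> by (auto simp: power2_eq_iff)
    qed
    moreover have "d' < d" using one_less_power[OF p1 k] d'0 by (simp add: d)
    moreover have "d' dvd n" by (simp add: m)
    ultimately show ?thesis using less.IH b c c_d' by blast
  qed
qed

text \<open>The root \<open>b\<close> keeps the prime-to-\<open>p\<close> part of \<open>a\<close>
  and replaces its \<open>p\<close>-part by a primitive root of order \<open>p ^ j\<close>. This is
  the move between indices that differ by a power of \<open>p\<close>.\<close>

lemma prim_root_neighbour:
  fixes a :: "'l::alg_closed_field"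
  assumes char: "CHAR('l) = 0" and p: "prime p" and h: "\<not> p dvd h" "h > 0"
    and a: "prim_root (p ^ i * h) a"
  shows "\<exists>b t. prim_root (p ^ j * h) b \<and> a ^ (p ^ t) = b ^ (p ^ t)"
proof -
  have p0: "p > 0" using p prime_gt_0_nat by blast
  obtain z :: 'l where z: "prim_root (p ^ j) z" using prim_root_exists[OF char, of "p ^ j"] p0 by auto
  have cop: "coprime (p ^ e) h" for e using p h by (simp add: prime_imp_coprime)
  obtain x y where xy: "p ^ i * x = h * y + 1"
    using bezout_nat[of "p ^ i" h] cop[of i] p0 by (auto simp: coprime_iff_gcd_eq_1)
  have hx: "coprime h x"
  proof (rule coprimeI)
    fix e assume "e dvd h" "e dvd x"
    then have "e dvd p ^ i * x" "e dvd h * y" by simp_all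
    then show "is_unit e" using xy by (metis dvd_add_right_iff)
  qed
  \<comment> \<open>The exponent \<open>p ^ i * x\<close> is 0 modulo \<open>p ^ i\<close> and 1
    modulo \<open>h\<close>, so this power of \<open>a\<close> is its prime-to-\<open>p\<close>
    part.\<close>
  define b where "b = z * a ^ (p ^ i * x)"
  note iff_a = prim_root_power_eq_1_iff[OF a] and iff_z = prim_root_power_eq_1_iff[OF z]
  have "prim_root (p ^ j * h) b"
  proof (rule prim_rootI_dvd)
    show "p ^ j * h > 0" using p0 h by simp
    fix k
    show "b ^ k = 1 \<longleftrightarrow> p ^ j * h dvd k"
    proof
      assume b: "b ^ k = 1"
      have bk: "b ^ k = z ^ k * a ^ (p ^ i * (x * k))"
        by (simp add: b_def power_mult_distrib mult.assoc flip: power_mult)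
      \<comment> \<open>Taking \<open>p ^ j\<close> for \<open>e\<close> removes the factor
        \<open>z\<close>, and taking \<open>h\<close> removes the factor \<open>a\<close>, so the
        two orders are tested separately.\<close>
      then have *: "z ^ (k * e) * a ^ (p ^ i * (x * k * e)) = 1" for e
      proof -
        have "z ^ (k * e) * a ^ (p ^ i * (x * k * e)) = (z ^ k * a ^ (p ^ i * (x * k))) ^ e"
          by (simp only: power_mult_distrib power_mult[symmetric] mult.assoc)
        then show ?thesis using b bk by simp
      qed
      have "z ^ (k * p ^ j) = 1" by (simp add: iff_z)
      then have "a ^ (p ^ i * (x * k * p ^ j)) = 1" using *[of "p ^ j"] by simp
      then have "h dvd x * k * p ^ j" using p0 by (simp add: iff_a)
      then have "h dvd k" using hx cop[of j]
        by (metis coprime_commute coprime_dvd_mult_left_iff coprime_dvd_mult_right_iff)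
      have "a ^ (p ^ i * (x * k * h)) = 1" by (simp add: iff_a)
      then have "z ^ (k * h) = 1" using *[of h] by simp
      then have "p ^ j dvd k" using cop[of j] by (simp add: iff_z coprime_dvd_mult_left_iff)
      then show "p ^ j * h dvd k" using \<open>h dvd k\<close> cop[of j] by (simp add: divides_mult)
    next
      assume k: "p ^ j * h dvd k"
      then have "z ^ k = 1" "a ^ (p ^ i * x * k) = 1"
        by (auto simp: iff_a iff_z mult.assoc intro: dvd_mult_left dvd_mult dvd_mult_right)
      then show "b ^ k = 1" by (simp add: b_def power_mult_distrib flip: power_mult)
    qed
  qed
  \<comment> \<open>The quotient of \<open>b\<close> by \<open>a\<close> is
    \<open>z * a ^ (h * y)\<close>, whose factors have orders dividing \<open>p ^ j\<close> and
    \<open>p ^ i\<close>.\<close>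
  moreover have "a ^ (p ^ (i + j)) = b ^ (p ^ (i + j))"
  proof -
    have "z ^ (p ^ (i + j)) = 1" by (simp add: iff_z power_add)
    moreover have "a ^ (h * y * p ^ (i + j)) = 1" by (simp add: iff_a power_add mult_ac)
    moreover have "b ^ (p ^ (i + j)) = z ^ (p ^ (i + j)) * (a ^ (h * y * p ^ (i + j)) * a ^ (p ^ (i + j)))"
      by (simp only: b_def xy power_mult_distrib flip: power_mult power_add) (simp add: algebra_simps)
    ultimately show ?thesis by simp
  qed
  ultimately show ?thesis by blast
qed

section \<open>Vanishing of an element of the completion at roots of unity\<close>

text \<open>For a primitive \<open>m\<close>th root \<open>b\<close> with \<open>m\<close> in the
  index set, the component at \<open>cyclo m ^ k\<close> determines the element modulo (q - b)^k, so
  order \<open>k\<close> is tested on that component.\<close>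

definition vanishes_at ::
    "('a::comm_ring_1 \<Rightarrow> 'l::field) \<Rightarrow> (int poly \<Rightarrow> 'a poly) \<Rightarrow> nat \<Rightarrow> 'l \<Rightarrow> bool" where
  "vanishes_at \<psi> D m b \<longleftrightarrow> (\<forall>k. [:-b, 1:] ^ k dvd map_poly \<psi> (D (cyclo m ^ k)))"

text \<open>The product is a common multiple through which the components at the two powers are
  compared. As the generators are indexed by a set, the exponents have to be added when
  \<open>m = m'\<close>.\<close>

lemma cyclo_powers_in_mult_set:
  assumes "m \<in> S" "m' \<in> S"
  shows "cyclo m ^ k * cyclo m' ^ l \<in> cyclo_mult_set S" "cyclo m ^ k \<in> cyclo_mult_set S"
proof -
  show *: "cyclo m ^ k \<in> cyclo_mult_set S" for k
    unfolding cyclo_mult_set_def using assms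
    by (intro CollectI exI[of _ "{m}"] exI[of _ "\<lambda>_. k"]) simp
  show "cyclo m ^ k * cyclo m' ^ l \<in> cyclo_mult_set S"
  proof (cases "m = m'")
    case True
    then show ?thesis using *[of "k + l"] by (simp add: power_add)
  next
    case False
    then show ?thesis unfolding cyclo_mult_set_def using assms
      by (intro CollectI exI[of _ "{m, m'}"] exI[of _ "\<lambda>i. if i = m then k else l"]) auto
  qed
qed

context
  fixes \<psi> :: "'a::{idom,ring_char_0} \<Rightarrow> 'l::alg_closed_field" and S :: "nat set"
    and D :: "int poly \<Rightarrow> 'a poly"
  assumes emb: "ring_embedding \<psi>" and S0: "0 \<notin> S" and D: "D \<in> cyc_limit S"
begin

lemmas char = ring_embedding_CHAR[OF emb]

text \<open>Compatibility gives divisibility by \<open>cyclo m ^ k\<close>, which contains the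
  factor (q - b)^k. So the expansion at \<open>b\<close> to order \<open>k\<close> can be read off
  any component above \<open>cyclo m ^ k\<close>.\<close>

lemma linear_power_dvd_diff:
  assumes m: "m \<in> S" and b: "prim_root m b" and f: "f \<in> cyclo_mult_set S" "cyclo m ^ k dvd f"
  shows "[:-b, 1:] ^ k dvd map_poly \<psi> (D f) - map_poly \<psi> (D (cyclo m ^ k))"
proof -
  have "m > 0" using m S0 by (auto intro: gr0I)
  have "[:-b, 1:] dvd (map_poly of_int (cyclo m) :: 'l poly)"
    unfolding cyclo_splits[OF char \<open>m > 0\<close>] using b by (intro dvd_prodI finite_prim_roots) simp
  then have "[:-b, 1:] ^ k dvd (map_poly of_int (cyclo m) :: 'l poly) ^ k"
    by (rule dvd_power_same)
  also have "\<dots> = map_poly \<psi> (map_poly of_int (cyclo m ^ k))"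
    by (simp add: ring_embedding_map_poly[OF emb]
        ring_embedding_map_poly(4)[OF ring_embedding_of_int[OF char]])
  also have "\<dots> dvd map_poly \<psi> (D f - D (cyclo m ^ k))"
    using D f cyclo_powers_in_mult_set[OF m m]
    by (intro ring_embedding_map_poly_dvd[OF emb]) (auto simp: cyc_limit_def)
  finally show ?thesis by (simp add: ring_embedding_map_poly[OF emb])
qed

text \<open>The component at \<open>cyclo m ^ K * cyclo m' ^ k\<close> sees both roots: it vanishes
  to order \<open>K\<close> at \<open>a\<close> and agrees to order \<open>k\<close> at
  \<open>b\<close> with the component under study. These are the approximants for
  \<open>vanishing_transfer\<close>.\<close>

lemma vanishes_at_step:
  assumes m: "m \<in> S" "m' \<in> S" and a: "prim_root m a" and b: "prim_root m' b"
    and p: "prime p" "p_adically_separated p TYPE('a)" and t: "a ^ (p ^ t) = b ^ (p ^ t)"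
    and V: "vanishes_at \<psi> D m a"
  shows "vanishes_at \<psi> D m' b"
  unfolding vanishes_at_def
proof
  fix k
  \<comment> \<open>Both orders divide \<open>N\<close>, so a single primitive \<open>N\<close>th
    root has \<open>a\<close> and \<open>b\<close> among its powers.\<close>
  define N where "N = m * m'"
  have "N > 0" using m S0 by (auto simp: N_def intro: gr0I)
  then obtain w :: 'l where w: "prim_root N w" using prim_root_exists[OF char] by blast
  have aN: "a ^ N = 1" and bN: "b ^ N = 1"
    by (simp_all add: N_def prim_root_power_eq_1_iff[OF a] prim_root_power_eq_1_iff[OF b])
  obtain i j where "a = w ^ i" "b = w ^ j"
    using root_of_unity_power_prim_root[OF w] aN bN by metis
  then have ab: "a \<in> adjoin \<psi> w" "b \<in> adjoin \<psi> w"
    using adjoin_power[OF emb adjoin_gen[OF emb]] by simp_all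
  show "[:-b, 1:] ^ k dvd map_poly \<psi> (D (cyclo m' ^ k))"
  proof (rule vanishing_transfer[OF emb w p ab aN t])
    fix K
    let ?f = "cyclo m ^ K * cyclo m' ^ k"
    have f: "?f \<in> cyclo_mult_set S" using m by (rule cyclo_powers_in_mult_set)
    have "[:-a, 1:] ^ K dvd map_poly \<psi> (D ?f) - map_poly \<psi> (D (cyclo m ^ K))"
      by (rule linear_power_dvd_diff[OF m(1) a f]) simp
    moreover have "[:-a, 1:] ^ K dvd map_poly \<psi> (D (cyclo m ^ K))"
      using V by (simp add: vanishes_at_def)
    ultimately have "[:-a, 1:] ^ K dvd map_poly \<psi> (D ?f)"
      by (metis diff_add_cancel dvd_add)
    moreover have "[:-b, 1:] ^ k dvd map_poly \<psi> (D ?f) - map_poly \<psi> (D (cyclo m' ^ k))"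
      by (rule linear_power_dvd_diff[OF m(2) b f]) simp
    ultimately show "\<exists>F. [:-a, 1:] ^ K dvd map_poly \<psi> F
        \<and> [:-b, 1:] ^ k dvd map_poly \<psi> F - map_poly \<psi> (D (cyclo m' ^ k))" by blast
  qed
qed

text \<open>The neighbour of order \<open>m\<close> is constructed from \<open>b\<close>, so
  vanishing is assumed at all primitive \<open>m\<close>th roots rather than at a chosen
  one.\<close>

lemma vanishes_at_neighbour:
  assumes m: "m \<in> S" "m' \<in> S" and rel: "cyc_rel TYPE('a) m m'"
    and V: "\<And>a. prim_root m a \<Longrightarrow> vanishes_at \<psi> D m a" and b: "prim_root m' b"
  shows "vanishes_at \<psi> D m' b"
proof (cases "m = m'")
  case True
  then show ?thesis using V b by simp
next
  case False
  have "(UNIV :: 'a set) \<noteq> {0}" by (metis UNIV_I singletonD zero_neq_one)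
  then obtain p k where p: "prime p" "p_adically_separated p TYPE('a)"
    and k: "m = m' * p ^ k \<or> m' = m * p ^ k"
    using rel False by (auto simp: cyc_rel_def)
  have m0: "m > 0" "m' > 0" using m S0 by (auto intro: gr0I)
  have p1: "p > 1" using p prime_gt_1_nat by blast
  have decomp: "\<exists>i h. l = p ^ i * h \<and> \<not> p dvd h" if l: "l > 0" for l :: nat
  proof -
    obtain h where "l = p ^ multiplicity p l * h" "\<not> p dvd h"
      using multiplicity_decompose'[of l p] l p1 by auto
    then show ?thesis by blast
  qed
  obtain i j h where h: "m = p ^ i * h" "m' = p ^ j * h" "\<not> p dvd h"
  proof (cases "m = m' * p ^ k")
    case True
    obtain j h where "m' = p ^ j * h" "\<not> p dvd h" using decomp m0 by blast
    then show ?thesis using that[of "j + k" h j] True by (simp add: power_add mult_ac)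
  next
    case False
    obtain i h where "m = p ^ i * h" "\<not> p dvd h" using decomp m0 by blast
    then show ?thesis using that[of i h "i + k"] False k by (simp add: power_add mult_ac)
  qed
  have "h > 0" using h m0 by (auto intro: gr0I)
  obtain a t where a: "prim_root m a" "b ^ (p ^ t) = a ^ (p ^ t)"
    using prim_root_neighbour[OF char p(1) h(3) \<open>h > 0\<close> b[unfolded h(2)]] h(1) by blast
  show ?thesis
    by (rule vanishes_at_step[OF m a(1) b p a(2)[symmetric] V[OF a(1)]])
qed

text \<open>Taken over all \<open>f\<close>, the conclusion says that \<open>D\<close> is zero in
  the completion. A single root \<open>z\<close> suffices, since vanishing spreads first over the
  primitive \<open>n\<close>th roots and then along \<open>S\<close>.\<close>

lemma cyc_limit_vanishes:
  assumes conn: "cyc_connected TYPE('a) S" and n: "n \<in> S"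
    and odd_sep: "\<And>p. prime p \<Longrightarrow> odd p \<Longrightarrow> p dvd n \<Longrightarrow> p_adically_separated p TYPE('a)"
    and two_sep: "4 dvd n \<Longrightarrow> p_adically_separated 2 TYPE('a)"
    and z: "prim_root n z" and V: "vanishes_at \<psi> D n z"
    and f: "f \<in> cyclo_mult_set S"
  shows "map_poly of_int f dvd D f"
proof -
  \<comment> \<open>The chain starts with \<open>d = n\<close>, because all \<open>n\<close>th roots
    of unity have the same \<open>n\<close>th power.\<close>
  have base: "vanishes_at \<psi> D n b" if b: "prim_root n b" for b
  proof (rule prim_roots_connected[where V = "vanishes_at \<psi> D n" and a = z and d = n
        and sep = "\<lambda>p. p_adically_separated p TYPE('a)", OF _ odd_sep two_sep dvd_refl z b _ V])
    show "z ^ n = b ^ n" using z b by (simp add: prim_root_def)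
  qed (use vanishes_at_step[OF n n] in blast)+
  have all: "vanishes_at \<psi> D m b" if m: "m \<in> S" and b: "prim_root m b" for m b
  proof -
    have "(\<lambda>x y. x \<in> S \<and> y \<in> S \<and> cyc_rel TYPE('a) x y)\<^sup>*\<^sup>* n m"
      using conn n m by (simp add: cyc_connected_def)
    then have "\<forall>b. prim_root m b \<longrightarrow> vanishes_at \<psi> D m b"
      by induction (use base vanishes_at_neighbour in auto)
    then show ?thesis using b by blast
  qed
  obtain M e where M: "finite M" "M \<subseteq> S" and f_eq: "f = (\<Prod>m\<in>M. cyclo m ^ e m)"
    using f by (auto simp: cyclo_mult_set_def)
  note oi = ring_embedding_of_int[OF char]
  \<comment> \<open>The index \<open>m\<close> is recovered from \<open>b\<close> as its order. The
    exponent thus depends on the root alone, and the double product merges into a single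
    one.\<close>
  define E where "E = (\<lambda>b::'l. e (THE m. prim_root m b))"
  have E: "E b = e m" if "prim_root m b" for m b
  proof -
    have "(THE m. prim_root m b) = m" using that prim_root_unique by blast
    then show ?thesis by (simp add: E_def)
  qed
  have M0: "m > 0" if "m \<in> M" for m using that M S0 by (auto intro: gr0I)
  have "map_poly \<psi> (map_poly of_int f) = (map_poly of_int f :: 'l poly)"
    by (simp add: ring_embedding_map_poly[OF emb])
  also have "\<dots> = (\<Prod>m\<in>M. \<Prod>b\<in>{b. prim_root m b}. [:-b, 1:] ^ E b)"
    unfolding f_eq ring_embedding_map_poly_prod[OF oi] ring_embedding_map_poly[OF oi]
    by (intro prod.cong refl) (simp add: cyclo_splits[OF char M0] E prod_power_distrib)
  also have "\<dots> = (\<Prod>b\<in>(\<Union>m\<in>M. {b. prim_root m b}). [:-b, 1:] ^ E b)"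
    by (rule prod.UNION_disjoint[symmetric])
      (use M in \<open>auto simp: finite_prim_roots dest: prim_root_unique\<close>)
  also have "\<dots> dvd map_poly \<psi> (D f)"
  proof (rule prod_linear_powers_dvd)
    show "finite (\<Union>m\<in>M. {b::'l. prim_root m b})" using M finite_prim_roots by auto
    fix b :: 'l assume "b \<in> (\<Union>m\<in>M. {b. prim_root m b})"
    then obtain m where m: "m \<in> M" "prim_root m b" by blast
    have "cyclo m ^ e m dvd f" unfolding f_eq using M m by (intro dvd_prodI)
    then have "[:-b, 1:] ^ e m dvd map_poly \<psi> (D f) - map_poly \<psi> (D (cyclo m ^ e m))"
      using M m f by (intro linear_power_dvd_diff) auto
    moreover have "[:-b, 1:] ^ e m dvd map_poly \<psi> (D (cyclo m ^ e m))"
      using all[of m b] M m by (auto simp: vanishes_at_def)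
    ultimately show "[:-b, 1:] ^ E b dvd map_poly \<psi> (D f)"
      unfolding E[OF m(2)] by (metis diff_add_cancel dvd_add)
  qed
  finally have dvd: "map_poly \<psi> (map_poly of_int f) dvd map_poly \<psi> (D f)" .
  have "lead_coeff f = 1"
    unfolding f_eq using M0 by (simp add: lead_coeff_prod lead_coeff_power lead_coeff_cyclo)
  then have "lead_coeff (map_poly of_int f :: 'a poly) = 1"
    by (simp add: coeff_map_poly map_poly_degree_eq)
  then show ?thesis using dvd by (rule monic_dvd_descent[OF emb])
qed

text \<open>The expansion map reads coefficient \<open>i\<close> off the component at exponent
  \<open>i + 1\<close>, whereas vanishing to order \<open>k\<close> concerns exponent
  \<open>k\<close>. For \<open>i < k\<close> the two components agree modulo (q - z)^(i+1), so
  coefficient \<open>i\<close> is the same.\<close>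

lemma vanishes_atI_coeff:
  assumes n: "n \<in> S" and z: "prim_root n z"
    and coeff: "\<And>i. coeff (pcompose (map_poly \<psi> (D (cyclo n ^ (i + 1)))) [:z, 1:]) i = 0"
  shows "vanishes_at \<psi> D n z"
  unfolding vanishes_at_def linear_power_dvd_iff_coeff
proof (intro allI impI)
  fix k i assume "i < (k :: nat)"
  then have "[:-z, 1:] ^ (i + 1) dvd map_poly \<psi> (D (cyclo n ^ k)) - map_poly \<psi> (D (cyclo n ^ (i + 1)))"
    by (intro linear_power_dvd_diff n z cyclo_powers_in_mult_set(2)[OF n n] le_imp_power_dvd) auto
  then show "coeff (pcompose (map_poly \<psi> (D (cyclo n ^ k))) [:z, 1:]) i = 0"
    using coeff[of i] unfolding linear_power_dvd_iff_coeff by (simp add: pcompose_diff)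
qed

end

section \<open>Injectivity of the expansion map\<close>

text \<open>Subtracting representatives reduces injectivity to a trivial kernel, and the field is
  enlarged to its algebraic closure, where the cyclotomic polynomials split.\<close>

lemma cyc_sigma_injective:
  fixes \<phi> :: "'a::{idom, ring_char_0} \<Rightarrow> 'b::field"
  assumes emb: "ring_embedding \<phi>" and S0: "0 \<notin> S" and conn: "cyc_connected TYPE('a) S"
    and n: "n \<in> S"
    and odd_sep: "\<And>p. prime p \<Longrightarrow> odd p \<Longrightarrow> p dvd n \<Longrightarrow> p_adically_separated p TYPE('a)"
    and two_sep: "4 dvd n \<Longrightarrow> p_adically_separated 2 TYPE('a)"
    and z: "prim_root n z"
    and gh: "g \<in> cyc_limit S" "h \<in> cyc_limit S" "cyc_sigma \<phi> n z g = cyc_sigma \<phi> n z h"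
  shows "cyc_limit_eq S g h"
proof -
  define \<psi> where "\<psi> = (\<lambda>x. to_ac (\<phi> x))"
  define D where "D = (\<lambda>f. g f - h f)"
  have ac: "ring_embedding (to_ac :: 'b \<Rightarrow> 'b alg_closure)"
    by (simp add: ring_embedding_def inj_to_ac)
  have emb': "ring_embedding \<psi>"
    using emb by (auto simp: \<psi>_def ring_embedding_def inj_def)
  have D: "D \<in> cyc_limit S"
  proof -
    have "map_poly of_int f dvd D f' - D f" if "f \<in> cyclo_mult_set S" "f' \<in> cyclo_mult_set S" "f dvd f'"
      for f f'
    proof -
      have "map_poly of_int f dvd (g f' - g f) - (h f' - h f)"
        by (rule dvd_diff) (use gh that in \<open>auto simp: cyc_limit_def\<close>)
      then show ?thesis by (simp add: D_def algebra_simps)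
    qed
    then show ?thesis by (simp add: cyc_limit_def)
  qed
  have z': "prim_root n (to_ac z)"
    using z by (auto simp: prim_root_def simp flip: to_ac_power to_ac_1 simp del: to_ac_1)
  have "vanishes_at \<psi> D n (to_ac z)"
  proof (rule vanishes_atI_coeff[OF emb' S0 D n z'])
    fix i
    let ?F = "\<lambda>g. pcompose (map_poly \<phi> (g (cyclo n ^ (i + 1)))) [:z, 1:]"
    have "map_poly \<psi> f = map_poly to_ac (map_poly \<phi> f)" for f
      by (rule poly_eqI)
        (simp add: \<psi>_def ring_embedding_map_poly(6)[OF ac] ring_embedding_map_poly(6)[OF emb]
          ring_embedding_map_poly(6)[OF emb', unfolded \<psi>_def])
    then have "pcompose (map_poly \<psi> (D (cyclo n ^ (i + 1)))) [:to_ac z, 1:] = map_poly to_ac (?F D)"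
      by (simp add: ring_embedding_map_poly_pcompose[OF ac] map_poly_pCons)
    moreover have "coeff (?F D) i = 0"
    proof -
      have "coeff (?F g) i = coeff (?F h) i"
        using fun_cong[OF arg_cong[where f = fps_nth, OF gh(3)], of i] by (simp add: cyc_sigma_def)
      then show ?thesis by (simp add: D_def ring_embedding_map_poly[OF emb] pcompose_diff)
    qed
    ultimately show "coeff (pcompose (map_poly \<psi> (D (cyclo n ^ (i + 1)))) [:to_ac z, 1:]) i = 0"
      by (simp add: ring_embedding_map_poly[OF ac])
  qed
  then show ?thesis
    using cyc_limit_vanishes[OF emb' S0 D conn n odd_sep two_sep z']
    by (auto simp: cyc_limit_eq_def D_def)
qed

section \<open>The ring of integers\<close>

lemma int_p_adically_separated:
  assumes "prime p"
  shows "p_adically_separated p TYPE(int)"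
  unfolding p_adically_separated_def
proof (intro allI impI)
  fix x :: int assume "\<forall>j. of_nat p ^ j dvd x"
  then show "x = 0"
    using finite_divisor_powers[of x "int p"] assms prime_gt_1_nat[OF assms] by auto
qed

text \<open>Stripping prime factors one at a time leads from \<open>m\<close> to 1, each prime being
  admissible over the integers. The induction carries both directions, so that any two positive
  integers are joined through 1.\<close>

lemma cyc_connected_int: "cyc_connected TYPE(int) {k. 0 < k}"
proof -
  define r where "r = (\<lambda>x y. x \<in> {k. 0 < k} \<and> y \<in> {k. 0 < k} \<and> cyc_rel TYPE(int) x y)"
  have rel: "cyc_rel TYPE(int) (p * m) m" "cyc_rel TYPE(int) m (p * m)" if "prime p" for p m
    using int_p_adically_separated[OF that] that unfolding cyc_rel_def
    by (metis mult.commute power_one_right)+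
  have "r\<^sup>*\<^sup>* m 1 \<and> r\<^sup>*\<^sup>* 1 m" if "m > 0" for m
    using that
  proof (induction m rule: less_induct)
    case (less m)
    show ?case
    proof (cases "m = 1")
      case False
      then obtain p l where p: "prime p" "m = p * l" using prime_factor_nat by (metis dvdE)
      then have l: "l > 0" "l < m" using less.prems prime_gt_1_nat[OF p(1)] by auto
      then have "r m l" "r l m" unfolding r_def using rel[OF p(1), of l] p less.prems by auto
      then show ?thesis using less.IH[OF l(2,1)]
        by (meson converse_rtranclp_into_rtranclp rtranclp.rtrancl_into_rtrancl)
    qed simp
  qed
  then show ?thesis unfolding cyc_connected_def r_def[symmetric]
    by (auto intro: rtranclp_trans)
qed

theorem theorem5p4:
  fixes \<phi> :: "'a::{idom, ring_char_0} \<Rightarrow> 'b::field"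
    and S :: "nat set" and n :: nat and \<zeta> :: 'b
  assumes "ring_embedding \<phi>"
    and "0 \<notin> S"
    and "cyc_connected TYPE('a) S"
    and "n \<in> S"
    and "\<And>p. prime p \<Longrightarrow> odd p \<Longrightarrow> p dvd n \<Longrightarrow> p_adically_separated p TYPE('a)"
    and "4 dvd n \<Longrightarrow> p_adically_separated 2 TYPE('a)"
    and "prim_root n \<zeta>"
  shows "(\<forall>g\<in>cyc_limit S. \<forall>h\<in>cyc_limit S.
            cyc_sigma \<phi> n \<zeta> g = cyc_sigma \<phi> n \<zeta> h \<longrightarrow> cyc_limit_eq S g h)
       \<and> (\<forall>m \<xi>. prim_root m \<xi> \<longrightarrow>
            (\<forall>g\<in>cyc_limit {k. 0 < k}. \<forall>h\<in>cyc_limit {k. 0 < k}.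
              cyc_sigma (of_int :: int \<Rightarrow> 'b) m \<xi> g = cyc_sigma (of_int :: int \<Rightarrow> 'b) m \<xi> h
              \<longrightarrow> cyc_limit_eq {k. 0 < k} g h))"
proof (intro conjI ballI allI impI)
  fix g h assume "g \<in> cyc_limit S" "h \<in> cyc_limit S" "cyc_sigma \<phi> n \<zeta> g = cyc_sigma \<phi> n \<zeta> h"
  then show "cyc_limit_eq S g h" using cyc_sigma_injective[OF assms] by blast
next
  fix m and \<xi> :: 'b and g h :: "int poly \<Rightarrow> int poly"
  assume \<xi>: "prim_root m \<xi>"
    and gh: "g \<in> cyc_limit {k. 0 < k}" "h \<in> cyc_limit {k. 0 < k}"
      "cyc_sigma (of_int :: int \<Rightarrow> 'b) m \<xi> g = cyc_sigma of_int m \<xi> h"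
  have m: "m \<in> {k. 0 < k}" using \<xi> by (simp add: prim_root_def)
  \<comment> \<open>The general statement over the integers. The field has characteristic 0 because
    \<open>\<phi>\<close> embeds a ring of characteristic 0 into it, so \<open>of_int\<close> is an
    embedding as well.\<close>
  show "cyc_limit_eq {k. 0 < k} g h"
    by (rule cyc_sigma_injective[OF ring_embedding_of_int[OF ring_embedding_CHAR[OF assms(1)]] _
          cyc_connected_int m _ _ \<xi> gh])
      (auto intro: int_p_adically_separated)
qed

end
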